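(* Let $h\ge 3$ be an integer. Let $A=\{a_1,a_2,\ldots,a_{h+1}\}$ be a set of $h+1$ positive integers with $a_1<a_2<\cdots<a_{h+1}$, $a_3-a_2<2a_1$, and $a_i-a_{i-1}>\frac{a_2-a_1}{2}$ for $i=4,\ldots,h+1$. Then $\left|h^{\wedge}_{\pm}A\right|\ge (h+1)^2+1$.
   Context: For a positive integer $h$ and a finite set of integers $A=\{a_1,\ldots,a_k\}$ (distinct elements), the restricted $h$-fold signed sumset is $h^{\wedge}_{\pm}A=\left\{\sum_{i=1}^k\lambda_i a_i:\lambda_i\in\{-1,0,1\},\ \sum_{i=1}^k|\lambda_i|=h\right\}$. *)

theory Defs
  imports Complex_Main
begin

text \<open>
  The restricted \<open>h\<close>-fold signed sumset of a finite set \<open>A\<close> of integers. The coefficients are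
  indexed by the elements of \<open>A\<close> themselves; only the values of \<open>c\<close> on \<open>A\<close> matter.
\<close>

definition restricted_signed_sumset :: "nat \<Rightarrow> int set \<Rightarrow> int set" where
  "restricted_signed_sumset h A =
     {\<Sum>a\<in>A. c a * a | c :: int \<Rightarrow> int.
        (\<forall>a\<in>A. c a \<in> {-1, 0, 1}) \<and> (\<Sum>a\<in>A. \<bar>c a\<bar>) = int h}"

end

(*
  Adding the sum of all a i to a signed sum and writing k = h + 1, one has to count the numbers
  a m + 2 * sum a B with B a subset of {1..k} - {m}. Below 2 a k + a 1 one finds the 2k - 1 numbers
    a 1 < a 2 < a 3 < 2 a 1 + a 2 < a 1 + 2 a 2 < 2 a 3 + a 1 < 2 a 3 + a 2 < 2 a 4 + a 1 < ...
        < 2 a (k-1) + a 2,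
  and all numbers 2 a k + x, with x coming from a 1, ..., a (k-1), are at least 2 a k + a 1.
  So passing from k - 1 to k gains 2k - 1 = k^2 - (k-1)^2 elements. For k = 3 there are
  3^2 + 1 of them, the extra one being 2 a 1 + 2 a 2 + a 3, the mirror image of a 3.
*)
theory Submission
  imports Defs
begin

text \<open>In the signed sum behind such a number, \<open>m\<close> is the index with coefficient
  0, \<open>B\<close> holds those with coefficient 1, and all other indices have coefficient
  -1.\<close>

definition one_plus_double_sums :: "(nat \<Rightarrow> int) \<Rightarrow> nat \<Rightarrow> int set" where
  "one_plus_double_sums a k =
     {a m + 2 * sum a B | m B. m \<in> {1..k} \<and> B \<subseteq> {1..k} - {m}}"

lemma one_plus_double_sums_mono:
  assumes "j \<le> k"
  shows "one_plus_double_sums a j \<subseteq> one_plus_double_sums a k"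
proof -
  have "{1..j} \<subseteq> {1..k}" using assms by auto
  then show ?thesis unfolding one_plus_double_sums_def by blast
qed

text \<open>Adjoining \<open>Suc k\<close> to \<open>B\<close> gives the new index coefficient 1; in
  the inclusion from \<open>k\<close> to \<open>Suc k\<close> it gets -1 instead.\<close>

lemma one_plus_double_sums_add:
  assumes "x \<in> one_plus_double_sums a k"
  shows "2 * a (Suc k) + x \<in> one_plus_double_sums a (Suc k)"
proof -
  obtain m B where mB: "x = a m + 2 * sum a B" "m \<in> {1..k}" "B \<subseteq> {1..k} - {m}"
    using assms unfolding one_plus_double_sums_def by blast
  then have "finite B" "Suc k \<notin> B" by (auto intro: finite_subset)
  then have "2 * a (Suc k) + x = a m + 2 * sum a (insert (Suc k) B)"
    using mB(1) by simp
  moreover have "m \<in> {1..Suc k}" "insert (Suc k) B \<subseteq> {1..Suc k} - {m}"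
    using mB by auto
  ultimately show ?thesis unfolding one_plus_double_sums_def by blast
qed

lemma one_plus_double_sumsI:
  assumes "m \<in> {1..k}" "B \<subseteq> {1..k} - {m}" "x = a m + 2 * sum a B"
  shows "x \<in> one_plus_double_sums a k"
  using assms unfolding one_plus_double_sums_def by blast

lemma one_plus_double_sums_2:
  "{a 1, a 2, 2 * a 1 + a 2, a 1 + 2 * a 2} \<subseteq> one_plus_double_sums a 2"
  using one_plus_double_sumsI[of 1 2 "{}" _ a] one_plus_double_sumsI[of 2 2 "{}" _ a]
    one_plus_double_sumsI[of 2 2 "{1}" _ a] one_plus_double_sumsI[of 1 2 "{2}" _ a]
  by (auto simp: add.commute)

lemma one_plus_double_sums_3:
  "{a 3, 2 * a 1 + 2 * a 2 + a 3} \<subseteq> one_plus_double_sums a 3"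
  using one_plus_double_sumsI[of 3 3 "{}" _ a] one_plus_double_sumsI[of 3 3 "{1,2}" _ a]
  by (auto simp: algebra_simps)

lemma double_add_in_one_plus_double_sums:
  assumes "x \<in> {a 1, a 2}" "3 \<le> i" "i \<le> k"
  shows "2 * a i + x \<in> one_plus_double_sums a k"
proof -
  obtain i' where i': "i = Suc i'" "2 \<le> i'" using assms(2) by (cases i) auto
  have "x \<in> one_plus_double_sums a i'"
    using assms(1) one_plus_double_sums_2[of a] one_plus_double_sums_mono[OF i'(2), of a] by blast
  then have "2 * a i + x \<in> one_plus_double_sums a i"
    using one_plus_double_sums_add i'(1) by blast
  then show ?thesis using one_plus_double_sums_mono[OF assms(3)] by blast
qed

definition low_sums :: "(nat \<Rightarrow> int) \<Rightarrow> nat \<Rightarrow> int set" where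
  "low_sums a k = {a 1, a 2, a 3, 2 * a 1 + a 2, a 1 + 2 * a 2} \<union>
     (\<Union>i\<in>{3..<k}. {2 * a i + a 1, 2 * a i + a 2})"

lemma finite_low_sums [simp]: "finite (low_sums a k)"
  unfolding low_sums_def by simp

lemma low_sums_subset:
  assumes "3 \<le> k"
  shows "low_sums a k \<subseteq> one_plus_double_sums a k"
proof -
  have "2 \<le> k" using assms by simp
  have "{a 1, a 2, a 3, 2 * a 1 + a 2, a 1 + 2 * a 2} \<subseteq> one_plus_double_sums a k"
    using one_plus_double_sums_2[of a] one_plus_double_sums_3[of a]
      one_plus_double_sums_mono[OF \<open>2 \<le> k\<close>, of a] one_plus_double_sums_mono[OF assms, of a]
    by blast
  moreover have "{2 * a i + a 1, 2 * a i + a 2} \<subseteq> one_plus_double_sums a k" if "i \<in> {3..<k}" for i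
    using that double_add_in_one_plus_double_sums[of _ a i k] by auto
  ultimately show ?thesis unfolding low_sums_def by blast
qed

lemma low_sums_Suc:
  "3 \<le> k \<Longrightarrow> low_sums a (Suc k) = insert (2 * a k + a 1) (insert (2 * a k + a 2) (low_sums a k))"
  unfolding low_sums_def by (auto simp: less_Suc_eq)

context
  fixes a :: "nat \<Rightarrow> int" and n :: nat
  assumes pos: "0 < a 1" and incr: "a 1 < a 2" "a 2 < a 3"
    and gap3: "a 3 - a 2 < 2 * a 1"
    and gaps: "\<And>k. 3 \<le> k \<Longrightarrow> k < n \<Longrightarrow> a 2 - a 1 < 2 * (a (Suc k) - a k)"
begin

text \<open>Both numbers added at \<open>Suc k\<close> lie above all earlier ones, so the size grows
  by 2 from 5. The gap hypothesis is exactly 2 * a k + a 2 < 2 * a (Suc k) + a 1, which keeps the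
  upper bound alive.\<close>

lemma low_sums_less_card:
  assumes "3 \<le> k" "k \<le> n"
  shows "(\<forall>x\<in>low_sums a k. a 1 \<le> x \<and> x < 2 * a k + a 1) \<and> card (low_sums a k) = 2 * k - 1"
  using assms
proof (induction k rule: nat_induct_at_least)
  case base
  have "low_sums a 3 = {a 1, a 2, a 3, 2 * a 1 + a 2, a 1 + 2 * a 2}"
    unfolding low_sums_def by simp
  \<comment> \<open>Here \<open>gap3\<close> separates \<open>a 3\<close> from 2 * a 1 + a 2; the
    rest of the chain follows from \<open>pos\<close> and \<open>incr\<close>.\<close>
  then show ?case using pos incr gap3 by auto
next
  case (Suc k)
  then have IH: "\<forall>x\<in>low_sums a k. a 1 \<le> x \<and> x < 2 * a k + a 1"
    and card: "card (low_sums a k) = 2 * k - 1" by simp_all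
  have gap: "a 2 - a 1 < 2 * (a (Suc k) - a k)" using gaps Suc by simp
  \<comment> \<open>As \<open>a 1\<close> is itself a low sum, the upper bound gives a 1 < 2 * a k +
    a 1.\<close>
  have ge: "0 \<le> a k"
    using IH unfolding low_sums_def by (auto simp: ball_Un)
  have new: "2 * a k + a 1 \<notin> low_sums a k" "2 * a k + a 2 \<notin> low_sums a k"
    using IH incr by force+
  have "card (low_sums a (Suc k)) = 2 * Suc k - 1"
    using new incr card Suc.hyps by (simp add: low_sums_Suc)
  moreover have "\<forall>x\<in>low_sums a (Suc k). a 1 \<le> x \<and> x < 2 * a (Suc k) + a 1"
    using IH gap incr ge Suc.hyps by (force simp: low_sums_Suc)
  ultimately show ?case by blast
qed

text \<open>The lower bound \<open>a 1\<close> on \<open>C\<close> is carried through the induction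
  because it puts the translate of \<open>C\<close> by 2 * a (Suc k) above all low sums, so that the
  two sets are disjoint.\<close>

lemma exists_square_many_sums:
  assumes "3 \<le> k" "k \<le> n"
  shows "\<exists>C \<subseteq> one_plus_double_sums a k. finite C \<and> card C = k\<^sup>2 + 1 \<and> (\<forall>x\<in>C. a 1 \<le> x)"
  using assms
proof (induction k rule: nat_induct_at_least)
  case base
  \<comment> \<open>The five low sums and their mirror images under x -> 2 * (a 1 + a 2 + a 3) - x.
    By \<open>gap3\<close> and a 2 < a 3, the image of \<open>a 3\<close> lies strictly between 2 *
    a 3 + a 2 and 2 * a 3 + 2 * a 1 + a 2.\<close>
  let ?C = "low_sums a 3 \<union> {2 * a 3 + a 1, 2 * a 3 + a 2, 2 * a 1 + 2 * a 2 + a 3,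
    2 * a 3 + (2 * a 1 + a 2), 2 * a 3 + (a 1 + 2 * a 2)}"
  have low: "low_sums a 3 = {a 1, a 2, a 3, 2 * a 1 + a 2, a 1 + 2 * a 2}"
    unfolding low_sums_def by simp
  have "2 * a 3 + x \<in> one_plus_double_sums a 3"
    if "x \<in> {a 1, a 2, 2 * a 1 + a 2, a 1 + 2 * a 2}" for x
    using that one_plus_double_sums_2[of a] one_plus_double_sums_add[of x a 2] by auto
  then have "?C \<subseteq> one_plus_double_sums a 3"
    using low_sums_subset[of 3 a] one_plus_double_sums_3[of a] by auto
  moreover have "card ?C = 3\<^sup>2 + 1"
    unfolding low using pos incr gap3 by simp
  moreover have "\<forall>x\<in>?C. a 1 \<le> x"
    unfolding low using pos incr by auto
  ultimately show ?case by (intro exI[of _ ?C]) simp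
next
  case (Suc k)
  then obtain C where C: "C \<subseteq> one_plus_double_sums a k" "finite C" "card C = k\<^sup>2 + 1"
    "\<forall>x\<in>C. a 1 \<le> x" by auto
  let ?L = "low_sums a (Suc k)" and ?U = "(\<lambda>x. 2 * a (Suc k) + x) ` C"
  have L: "\<forall>x\<in>?L. a 1 \<le> x \<and> x < 2 * a (Suc k) + a 1" "card ?L = 2 * Suc k - 1"
    using low_sums_less_card[of "Suc k"] Suc by simp_all
  have U: "\<forall>x\<in>?U. 2 * a (Suc k) + a 1 \<le> x" using C(4) by auto
  \<comment> \<open>Any low sum x has a 1 \<le> x < 2 * a (Suc k) + a 1, so the translate of
    \<open>C\<close> stays above \<open>a 1\<close>.\<close>
  have "?L \<noteq> {}" unfolding low_sums_def by blast
  then have "\<forall>x\<in>?U. a 1 \<le> x" using U L(1) by force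
  have "?L \<inter> ?U = {}" using U L(1) by force
  moreover have "card ?U = k\<^sup>2 + 1" using C(3) by (simp add: card_image)
  ultimately have "card (?L \<union> ?U) = (2 * Suc k - 1) + (k\<^sup>2 + 1)"
    using L(2) C(2) by (simp add: card_Un_disjoint)
  then have "card (?L \<union> ?U) = (Suc k)\<^sup>2 + 1" by (simp add: power2_eq_square)
  moreover have "?L \<union> ?U \<subseteq> one_plus_double_sums a (Suc k)"
    using low_sums_subset[of "Suc k" a] one_plus_double_sums_add C(1) Suc.hyps by auto
  ultimately show ?case
    using L(1) \<open>\<forall>x\<in>?U. a 1 \<le> x\<close> C(2) by (intro exI[of _ "?L \<union> ?U"]) auto
qed

end

lemma finite_restricted_signed_sumset:
  assumes "finite A"
  shows "finite (restricted_signed_sumset h A)"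
proof (rule finite_subset)
  let ?M = "\<Sum>a\<in>A. \<bar>a\<bar>"
  show "restricted_signed_sumset h A \<subseteq> {-?M..?M}"
  proof
    fix x assume "x \<in> restricted_signed_sumset h A"
    then obtain c where c: "x = (\<Sum>a\<in>A. c a * a)" "\<forall>a\<in>A. c a \<in> {-1, 0, 1}"
      unfolding restricted_signed_sumset_def by blast
    have "\<bar>x\<bar> \<le> (\<Sum>a\<in>A. \<bar>c a * a\<bar>)" unfolding c(1) by (rule sum_abs)
    also have "\<dots> \<le> ?M" by (rule sum_mono) (use c(2) in auto)
    finally show "x \<in> {-?M..?M}" by auto
  qed
qed simp

lemma one_plus_double_sums_shift:
  assumes inj: "inj_on a {1..Suc h}" and x: "x \<in> one_plus_double_sums a (Suc h)"
  shows "x - sum a {1..Suc h} \<in> restricted_signed_sumset h (a ` {1..Suc h})"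
proof -
  let ?I = "{1..Suc h}"
  obtain m B where mB: "x = a m + 2 * sum a B" "m \<in> ?I" "B \<subseteq> ?I - {m}"
    using x unfolding one_plus_double_sums_def by blast
  define d :: "nat \<Rightarrow> int" where "d i = (if i = m then 0 else if i \<in> B then 1 else -1)" for i
  \<comment> \<open>Coefficients belong to elements of the set, so \<open>d\<close> is transported
    from indices along the inverse of \<open>a\<close>.\<close>
  define c where "c y = d (the_inv_into ?I a y)" for y
  have c: "c (a i) = d i" if "i \<in> ?I" for i
    using the_inv_into_f_f[OF inj that] unfolding c_def by simp
  have "(\<Sum>y\<in>a ` ?I. c y * y) = (\<Sum>i\<in>?I. d i * a i)"
    unfolding sum.reindex[OF inj] by (rule sum.cong) (use c in simp_all)
  \<comment> \<open>Pointwise, \<open>d i\<close> is [i = m] + 2 * [i \<in> B] - 1; the two brackets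
    never hold together since \<open>m\<close> is not in \<open>B\<close>.\<close>
  also have "\<dots> = (\<Sum>i\<in>?I. (if i = m then a i else 0) + (if i \<in> B then 2 * a i else 0) - a i)"
    by (rule sum.cong) (use mB(3) in \<open>auto simp: d_def\<close>)
  also have "\<dots> = a m + (\<Sum>i\<in>?I. if i \<in> B then 2 * a i else 0) - sum a ?I"
    using mB(2) by (simp only: sum_subtractf sum.distrib sum.delta finite_atLeastAtMost if_True)
  also have "(\<Sum>i\<in>?I. if i \<in> B then 2 * a i else 0) = 2 * sum a B"
  proof -
    have "?I \<inter> B = B" using mB(3) by blast
    then show ?thesis
      using sum.inter_restrict[of ?I "\<lambda>i. 2 * a i" B] by (simp add: sum_distrib_left)
  qed
  finally have "(\<Sum>y\<in>a ` ?I. c y * y) = x - sum a ?I" using mB(1) by simp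
  moreover have "(\<Sum>y\<in>a ` ?I. \<bar>c y\<bar>) = int h"
  proof -
    have "(\<Sum>y\<in>a ` ?I. \<bar>c y\<bar>) = (\<Sum>i\<in>?I. \<bar>d i\<bar>)"
      unfolding sum.reindex[OF inj] by (rule sum.cong) (use c in simp_all)
    also have "\<dots> = (\<Sum>i\<in>?I - {m}. 1)"
      by (rule sum.mono_neutral_cong_right) (auto simp: d_def)
    also have "\<dots> = int h" using mB(2) by simp
    finally show ?thesis .
  qed
  moreover have "\<forall>y\<in>a ` ?I. c y \<in> {-1, 0, 1}" unfolding c_def d_def by simp
  ultimately show ?thesis
    unfolding restricted_signed_sumset_def mem_Collect_eq by (intro exI[of _ c]) simp
qed

theorem theorem2p10:
  fixes h :: nat and a :: "nat \<Rightarrow> int" and A :: "int set"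
  assumes "h \<ge> 3"
    and "A = a ` {1..h+1}"
    and "\<forall>i\<in>{1..h+1}. a i > 0"
    and "strict_mono_on {1..h+1} a"
    and "a 3 - a 2 < 2 * a 1"
    and "\<forall>i\<in>{4..h+1}. real_of_int (a i - a (i - 1)) > real_of_int (a 2 - a 1) / 2"
  shows "card (restricted_signed_sumset h A) \<ge> (h + 1)^2 + 1"
proof -
  have A: "A = a ` {1..Suc h}" using assms(2) by simp
  have inj: "inj_on a {1..Suc h}"
    using assms(4) strict_mono_on_imp_inj_on by fastforce
  have pos: "0 < a 1" using assms(3) by simp
  have incr: "a 1 < a 2" "a 2 < a 3"
    using assms(1) by (auto intro!: strict_mono_onD[OF assms(4)])
  have gaps: "a 2 - a 1 < 2 * (a (Suc k) - a k)" if "3 \<le> k" "k < Suc h" for k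
  proof -
    have "real_of_int (a 2 - a 1) / 2 < real_of_int (a (Suc k) - a k)"
      \<comment> \<open>The hypothesis names a gap by its upper index, \<open>gaps\<close> by its
        lower one.\<close>
      using bspec[OF assms(6), of "Suc k"] that by simp
    then have "real_of_int (a 2 - a 1) < real_of_int (2 * (a (Suc k) - a k))" by simp
    then show ?thesis by (simp only: of_int_less_iff)
  qed
  obtain C where C: "C \<subseteq> one_plus_double_sums a (Suc h)" "card C = (Suc h)\<^sup>2 + 1"
    using exists_square_many_sums[OF pos incr assms(5) gaps, of "Suc h" "Suc h"] assms(1) by auto
  let ?f = "\<lambda>x. x - sum a {1..Suc h}"
  have "(h + 1)^2 + 1 = card (?f ` C)" using C(2) by (simp add: card_image inj_on_def)
  also have "\<dots> \<le> card (restricted_signed_sumset h A)"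
    using C(1) one_plus_double_sums_shift[OF inj] A
    by (intro card_mono finite_restricted_signed_sumset) auto
  finally show ?thesis .
qed

end
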